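(* (1) Let $3\le t\le 9$ and let $p,q$ be distinct primes with $p,q\le 19$. Then every solution in non-negative integers $\alpha_1,\dots,\alpha_t$ of $$1+p^{\alpha_1}+\dots+p^{\alpha_{t-1}}-q^{\alpha_t}=0$$ satisfies $\min_{1\le i\le t}\alpha_i\le 6$. (2) The equation $$1+5^{\alpha_1}+5^{\alpha_2}+5^{\alpha_3}+5^{\alpha_4}+5^{\alpha_5}+5^{\alpha_6}+5^{\alpha_7}+5^{\alpha_8}-17^{\alpha_9}=0$$ has exactly two solutions in non-negative integers $\alpha_1,\dots,\alpha_9$ with $\alpha_1\le\alpha_2\le\dots\le\alpha_8$, namely $(\alpha_1,\dots,\alpha_9)=(0,0,0,0,0,0,1,1,1)$ and $(0,0,0,1,1,2,3,3,2)$. *)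

theory Defs
  imports Main "HOL-Computational_Algebra.Primes"
begin

end

theory Submission
  imports Defs "HOL-Number_Theory.Mod_Exp"
begin

text \<open>
  A sum of \<open>k\<close> powers of \<open>p\<close> has base-\<open>p\<close> digit sum at most \<open>k\<close>, so every solution forces
  \<open>q ^ b\<close> to have digit sum at most 9. The digit sum of \<open>x > 0\<close> does not increase when blocks of
  \<open>n\<close> digits are added together, that is, when \<open>x\<close> is replaced by its representative modulo
  \<open>p ^ n - 1\<close> in \<open>{1..p ^ n - 1}\<close>. That representative of \<open>q ^ b\<close> depends only on the class of
  \<open>b\<close> modulo some period. The same holds for the last \<open>N\<close> digits of \<open>q ^ b\<close>; these may be split
  off first, as digit sums of the two parts add up. A finite case distinction on residue classes
  of \<open>b\<close> therefore excludes all large \<open>b\<close>. In the first part \<open>q ^ b\<close> is moreover congruent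
  to 1 modulo \<open>p ^ 7\<close>, which excludes most classes at once.
\<close>

section \<open>Digit sums and their subadditivity\<close>

fun digit_sum :: "nat \<Rightarrow> nat \<Rightarrow> nat" where
  "digit_sum p x = (if p < 2 \<or> x = 0 then 0 else x mod p + digit_sum p (x div p))"

declare digit_sum.simps [simp del]

lemma digit_sum_0 [simp]: "digit_sum p 0 = 0"
  by (simp add: digit_sum.simps)

lemma digit_sum_rec: "p \<ge> 2 \<Longrightarrow> digit_sum p x = x mod p + digit_sum p (x div p)"
  by (cases "x = 0") (simp_all add: digit_sum.simps [of p x])

lemma digit_sum_mult_base:
  assumes "p \<ge> 2"
  shows "digit_sum p (p ^ n * x) = digit_sum p x"
proof (induction n)
  case (Suc n)
  have "p ^ Suc n * x mod p = 0" "p ^ Suc n * x div p = p ^ n * x"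
    using assms by (simp_all add: mult.assoc)
  then show ?case
    using assms Suc.IH digit_sum_rec [of p "p ^ Suc n * x"] by simp
qed simp

text \<open>Either the last digit grows by 1, or a last digit \<open>p - 1\<close> becomes 0 and the
  carry adds at most 1 to the rest by induction.\<close>

lemma digit_sum_Suc_le:
  assumes "p \<ge> 2"
  shows "digit_sum p (Suc x) \<le> Suc (digit_sum p x)"
proof (induction x rule: less_induct)
  case (less x)
  show ?case
  proof (cases "Suc (x mod p) = p")
    case False
    then show ?thesis
      using assms digit_sum_rec [of p x] digit_sum_rec [of p "Suc x"]
      by (simp add: mod_Suc div_Suc)
  next
    case True
    then have "x > 0" using assms by (cases x) auto
    then have "x div p < x" using assms by simp
    from less.IH [OF this] show ?thesis
      using assms digit_sum_rec [of p x] digit_sum_rec [of p "Suc x"] True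
      by (simp add: mod_Suc div_Suc)
  qed
qed

lemma digit_sum_add_small:
  assumes "p \<ge> 2"
  shows "digit_sum p (x + k) \<le> digit_sum p x + k"
proof (induction k)
  case (Suc k)
  then show ?case using digit_sum_Suc_le [OF assms, of "x + k"] by simp
qed simp

text \<open>A carry \<open>c\<close> takes \<open>c * p\<close> away from the current position and
  adds at most \<open>c\<close> to the digit sum of the rest.\<close>

lemma digit_sum_add_le:
  assumes "p \<ge> 2"
  shows "digit_sum p (x + y) \<le> digit_sum p x + digit_sum p y"
proof (induction x arbitrary: y rule: less_induct)
  case (less x)
  show ?case
  proof (cases "x = 0")
    case False
    then have lt: "x div p < x" using assms by simp
    define c where "c = (x mod p + y mod p) div p"
    have "(x + y) div p = x div p + y div p + c"
      unfolding c_def by (rule div_add1_eq)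
    then have "digit_sum p (x + y) \<le> (x + y) mod p + (digit_sum p (x div p) + digit_sum p (y div p) + c)"
      using digit_sum_rec [OF assms, of "x + y"] less.IH [OF lt, of "y div p"]
        digit_sum_add_small [OF assms, of "x div p + y div p" c] by simp
    moreover have "(x + y) mod p + c \<le> x mod p + y mod p"
    proof -
      have "x mod p + y mod p = c * p + (x + y) mod p"
        unfolding c_def using div_mult_mod_eq [of "x mod p + y mod p" p] by (simp add: mod_add_eq)
      moreover have "c \<le> c * p" using assms by simp
      ultimately show ?thesis by linarith
    qed
    ultimately show ?thesis
      using digit_sum_rec [OF assms, of x] digit_sum_rec [OF assms, of y] by linarith
  qed simp
qed

lemma digit_sum_power [simp]: "p \<ge> 2 \<Longrightarrow> digit_sum p (p ^ n) = 1"
  using digit_sum_mult_base [of p n 1] digit_sum_rec [of p 1] by simp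

lemma digit_sum_sum_powers_le:
  assumes "p \<ge> 2" "finite A"
  shows "digit_sum p (\<Sum>i\<in>A. p ^ f i) \<le> card A"
  using assms(2)
proof (induction A rule: finite_induct)
  case (insert a A)
  then show ?case
    using digit_sum_add_le [OF assms(1), of "p ^ f a" "\<Sum>i\<in>A. p ^ f i"] assms(1) by simp
qed simp

section \<open>Splitting numbers into blocks of digits and folding the blocks\<close>

lemma digit_sum_split:
  assumes "p \<ge> 2"
  shows "digit_sum p x = digit_sum p (x mod p ^ n) + digit_sum p (x div p ^ n)"
proof (induction n arbitrary: x)
  case (Suc n)
  have "x mod p ^ Suc n mod p = x mod p"
    by (simp add: mod_mod_cancel)
  moreover have "x mod p ^ Suc n div p = (x div p) mod p ^ n"
    using assms by (simp add: mod_mult2_eq)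
  ultimately have "digit_sum p (x mod p ^ Suc n) = x mod p + digit_sum p ((x div p) mod p ^ n)"
    using digit_sum_rec [OF assms, of "x mod p ^ Suc n"] by simp
  then show ?case
    using Suc.IH [of "x div p"] digit_sum_rec [OF assms, of x] by (simp add: div_mult2_eq)
qed simp

text \<open>Since \<open>p ^ n\<close> is 1 modulo \<open>p ^ n - 1\<close>, adding the leading part
  to the last \<open>n\<close> digits keeps the residue. It makes \<open>x\<close> smaller but not 0
  and, by subadditivity, does not raise the digit sum; iteration ends at \<open>y\<close>.\<close>

lemma digit_sum_fold_le:
  assumes "p \<ge> 2" "x > 0" "0 < y" "y \<le> p ^ n - 1" "[x = y] (mod (p ^ n - 1))"
  shows "digit_sum p y \<le> digit_sum p x"
  using assms(2,5)
proof (induction x rule: less_induct)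
  case (less x)
  have pn: "p ^ n > 1" using assms(3,4) by linarith
  show ?case
  proof (cases "x < p ^ n")
    case True
    then have "x \<le> p ^ n - 1" by simp
    have "x = y"
    \<comment> \<open>On 1, ..., \<open>p ^ n - 1\<close> congruence means equality, but the
      endpoint has residue 0 and is settled by divisibility.\<close>
    proof (cases "x = p ^ n - 1 \<or> y = p ^ n - 1")
      case True
      then have "p ^ n - 1 dvd x \<and> p ^ n - 1 dvd y"
        using cong_dvd_iff [OF less.prems(2)] by auto
      then show ?thesis
        using less.prems(1) assms(3,4) \<open>x \<le> p ^ n - 1\<close> by (meson dvd_imp_le le_antisym le_trans)
    next
      case False
      then show ?thesis
        using less.prems(2) assms(4) \<open>x \<le> p ^ n - 1\<close> by (simp add: cong_def)
    qed
    then show ?thesis by simp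
  next
    case False
    define x' where "x' = x mod p ^ n + x div p ^ n"
    have hi: "x div p ^ n > 0" using False assms(1) by (simp add: div_greater_zero_iff)
    have x: "x = x' + (p ^ n - 1) * (x div p ^ n)"
      using pn mod_mult_div_eq [of x "p ^ n"] by (simp add: x'_def algebra_simps)
    have "(p ^ n - 1) * (x div p ^ n) > 0" using hi pn by simp
    with x have "x' < x" by linarith
    moreover have "x' > 0" using hi by (simp add: x'_def)
    moreover have "[x' = y] (mod (p ^ n - 1))"
      using less.prems(2) by (subst (asm) x) (simp add: cong_def)
    ultimately have "digit_sum p y \<le> digit_sum p x'"
      by (rule less.IH)
    also have "\<dots> \<le> digit_sum p x"
      using digit_sum_add_le [OF assms(1)] digit_sum_split [OF assms(1), of x n]
      by (simp add: x'_def)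
    finally show ?thesis .
  qed
qed

text \<open>Folding keeps a number positive, so a positive multiple of \<open>m\<close> ends at
  \<open>m\<close> and not at 0.\<close>

definition fold_rep :: "nat \<Rightarrow> nat \<Rightarrow> nat" where
  "fold_rep m y = (if y mod m = 0 then m else y mod m)"

lemma fold_rep_bounds: "m > 0 \<Longrightarrow> 0 < fold_rep m y \<and> fold_rep m y \<le> m"
  by (auto simp: fold_rep_def less_imp_le)

lemma fold_rep_cong: "[fold_rep m y = y] (mod m)"
  by (simp add: fold_rep_def cong_def)

lemma fold_rep_eqI: "[y = z] (mod m) \<Longrightarrow> fold_rep m y = fold_rep m z"
  by (simp add: fold_rep_def cong_def)

section \<open>Certificates and their checker\<close>

text \<open>
  A certificate shows that no exponent in the class \<open>b, b + P, b + 2 * P, \<dots>\<close> gives a power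
  of \<open>q\<close> that is 1 modulo \<open>p ^ h\<close> and has digit sum at most 9.
  \<open>Cong N\<close>: already modulo \<open>p ^ N\<close> the power is not 1.
  \<open>Fold N n f\<close>: the last \<open>N\<close> digits are constant on the class, the residue of the power modulo
  \<open>p ^ n - 1\<close> runs through a cycle of length \<open>f\<close>, and at each point of the cycle the digit sum
  of the last \<open>N\<close> digits and that of the folded remaining part add up to more than 9. The bound
  \<open>q ^ s\<close>, where \<open>s\<close> is a lower bound of all exponents considered, makes sure that the
  remaining part is not 0.
  \<open>Split cs\<close>: a case distinction on the exponent modulo \<open>P * length cs\<close>.
\<close>

datatype cert = Cong nat | Fold nat nat nat | Split "cert list"

text \<open>
  These checks are separate constants, rather than let-expressions, so that the simplifier
  evaluates the arguments to numerals before it unfolds them.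
\<close>

definition cong_check :: "nat \<Rightarrow> nat \<Rightarrow> nat \<Rightarrow> bool" where
  "cong_check m x x' \<longleftrightarrow> x \<noteq> 1 mod m \<and> x' = x"

fun cycle_check :: "nat \<Rightarrow> nat \<Rightarrow> nat \<Rightarrow> nat \<Rightarrow> nat \<Rightarrow> nat \<Rightarrow> nat \<Rightarrow> nat \<Rightarrow> bool" where
  "cycle_check p d r m g y x 0 \<longleftrightarrow> x = y"
| "cycle_check p d r m g y x (Suc k) \<longleftrightarrow>
     9 < d + digit_sum p (fold_rep m (x + r)) \<and> cycle_check p d r m g y (x * g mod m) k"

definition fold_check :: "nat \<Rightarrow> nat \<Rightarrow> nat \<Rightarrow> nat \<Rightarrow> nat \<Rightarrow> nat \<Rightarrow> nat \<Rightarrow> nat \<Rightarrow> bool" where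
  "fold_check p c l l' m g x f \<longleftrightarrow> l' = l \<and> m > 0 \<and> l < c \<and> f > 0 \<and>
     cycle_check p (digit_sum p l) (m - l mod m) m g x x f"

text \<open>Branch \<open>i\<close> of a \<open>Split\<close> starts at \<open>b + i * P\<close>.
  \<open>refutes_all\<close> moves the start by the old period \<open>P\<close>, while
  \<open>Q\<close> carries the refined period that each branch receives.\<close>

fun refutes :: "nat \<Rightarrow> nat \<Rightarrow> nat \<Rightarrow> nat \<Rightarrow> nat \<Rightarrow> nat \<Rightarrow> cert \<Rightarrow> bool"
  and refutes_all :: "nat \<Rightarrow> nat \<Rightarrow> nat \<Rightarrow> nat \<Rightarrow> nat \<Rightarrow> nat \<Rightarrow> nat \<Rightarrow> cert list \<Rightarrow> bool"
where
  "refutes p q h s b P (Cong N) =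
     (N \<le> h \<and> cong_check (p ^ N) (mod_exp q b (p ^ N)) (mod_exp q (b + P) (p ^ N)))"
| "refutes p q h s b P (Fold N n f) =
     fold_check p (q ^ s) (mod_exp q b (p ^ N)) (mod_exp q (b + P) (p ^ N))
       (p ^ n - 1) (mod_exp q P (p ^ n - 1)) (mod_exp q b (p ^ n - 1)) f"
| "refutes p q h s b P (Split cs) = (cs \<noteq> [] \<and> refutes_all p q h s b P (P * length cs) cs)"
| "refutes_all p q h s b P Q [] = True"
| "refutes_all p q h s b P Q (c # cs) = (refutes p q h s b Q c \<and> refutes_all p q h s (b + P) P Q cs)"

section \<open>Soundness of the checker\<close>

lemma power_mod_periodic:
  fixes q :: nat
  assumes "q ^ (b + P) mod m = q ^ b mod m"
  shows "q ^ (b + j * P) mod m = q ^ b mod m"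
proof (induction j)
  case (Suc j)
  have "q ^ (b + Suc j * P) = q ^ (b + j * P) * q ^ P"
    by (simp add: power_add algebra_simps)
  then have "q ^ (b + Suc j * P) mod m = q ^ b * q ^ P mod m"
    using Suc.IH by (metis mod_mult_left_eq)
  then show ?case
    using assms by (simp add: power_add)
qed simp

lemma cycle_check_sound:
  assumes "cycle_check p d r m g y x k"
  shows "[x * g ^ k = y] (mod m)"
    and "i < k \<Longrightarrow> 9 < d + digit_sum p (fold_rep m (x * g ^ i + r))"
  using assms
proof (induction k arbitrary: x i)
  case 0
  { case 1 then show ?case by simp next case 2 then show ?case by simp }
next
  case (Suc k)
  have step: "[(x * g mod m) * g ^ i = x * g ^ Suc i] (mod m)" for x i
    by (simp add: cong_def mod_mult_left_eq mult.assoc)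
  {
    case 1
    then have "[(x * g mod m) * g ^ k = y] (mod m)"
      using Suc.IH(1) by simp
    with cong_sym [OF step [of x k]] show ?case
      by (rule cong_trans)
  next
    case 2
    show ?case
    proof (cases i)
      case 0
      then show ?thesis using 2 by simp
    next
      case (Suc i')
      then have "9 < d + digit_sum p (fold_rep m ((x * g mod m) * g ^ i' + r))"
        using 2 Suc.IH(2) [of i' "x * g mod m"] by simp
      then show ?thesis
        using fold_rep_eqI [OF cong_add [OF step [of x i'] cong_refl [of r]]] Suc by simp
    qed
  }
qed

text \<open>On natural numbers \<open>m - l mod m\<close> stands in for the negative of
  \<open>l\<close>; it is the shift \<open>r\<close> of \<open>cycle_check\<close>.\<close>

lemma cong_diff_mod:
  fixes x z l m :: nat
  assumes "m > 0" "l \<le> z" "[z = x] (mod m)"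
  shows "[z - l = x + (m - l mod m)] (mod m)"
proof -
  have "l mod m \<le> m" using assms(1) by (simp add: less_imp_le)
  then have "[x + (m - l mod m) + l mod m = x] (mod m)"
    by (simp add: cong_def)
  then have "[x + (m - l mod m) + l mod m = z] (mod m)"
    using assms(3) by (meson cong_sym cong_trans)
  then have "[x + (m - l mod m) + l = z - l + l] (mod m)"
    using assms(2) by (simp add: cong_def mod_add_right_eq)
  then show ?thesis
    by (simp only: cong_add_rcancel_nat cong_sym_eq)
qed

lemma refutes_Cong_sound:
  assumes "refutes p q h s b P (Cong N)"
  shows "\<not> [q ^ (b + j * P) = 1] (mod p ^ h)"
proof
  assume *: "[q ^ (b + j * P) = 1] (mod p ^ h)"
  have "N \<le> h" and ne: "q ^ b mod p ^ N \<noteq> 1 mod p ^ N"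
    and "q ^ (b + P) mod p ^ N = q ^ b mod p ^ N"
    using assms by (simp_all add: mod_exp_def cong_check_def)
  then have "q ^ (b + j * P) mod p ^ N \<noteq> 1 mod p ^ N"
    using power_mod_periodic by metis
  moreover have "[q ^ (b + j * P) = 1] (mod p ^ N)"
    using * \<open>N \<le> h\<close> by (meson cong_dvd_modulus_nat le_imp_power_dvd)
  ultimately show False by (simp add: cong_def)
qed

lemma refutes_Fold_sound:
  assumes "refutes p q h s b P (Fold N n f)" "p \<ge> 2" "q \<ge> 2" "s \<le> b"
  shows "9 < digit_sum p (q ^ (b + j * P))"
proof -
  define l where "l = q ^ b mod p ^ N"
  define m where "m = p ^ n - 1"
  define z where "z = q ^ (b + j * P)"
  \<comment> \<open>Modulo \<open>m\<close> only \<open>j mod f\<close> matters: \<open>w\<close>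
    will be congruent to \<open>z\<close>, and \<open>y\<close> to \<open>z - l\<close>.\<close>
  define w where "w = (q ^ b mod m) * (q ^ P mod m) ^ (j mod f)"
  define y where "y = fold_rep m (w + (m - l mod m))"
  have l: "q ^ (b + P) mod p ^ N = l" and "m > 0" "l < q ^ s" "f > 0"
    and cycle: "cycle_check p (digit_sum p l) (m - l mod m) m (q ^ P mod m) (q ^ b mod m) (q ^ b mod m) f"
    using assms(1) by (simp_all add: mod_exp_def fold_check_def l_def m_def)
  have zl: "z mod p ^ N = l"
    using power_mod_periodic [of q b P "p ^ N" j] l by (simp add: z_def l_def)
  have red: "[q ^ (b + i * P) = (q ^ b mod m) * (q ^ P mod m) ^ i] (mod m)" for i
    by (simp add: cong_def power_add power_mult mult.commute [of i] mod_mult_eq power_mod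
        flip: mod_mult_right_eq [of "q ^ b mod m" "(q ^ P mod m) ^ i"])
  have "q ^ (b + f * P) mod m = q ^ b mod m"
    using cong_trans [OF red cycle_check_sound(1) [OF cycle]] by (simp add: cong_def)
  then have "q ^ (b + f * P) * q ^ ((j mod f) * P) mod m = q ^ b * q ^ ((j mod f) * P) mod m"
    by (metis mod_mult_left_eq)
  then have "q ^ (b + (j mod f) * P + f * P) mod m = q ^ (b + (j mod f) * P) mod m"
    by (simp add: power_add mult_ac)
  \<comment> \<open>With \<open>f * P\<close> as period, the \<open>j div f\<close> full cycles drop
    out.\<close>
  then have "[q ^ (b + (j mod f) * P + (j div f) * (f * P)) = q ^ (b + (j mod f) * P)] (mod m)"
    unfolding cong_def by (rule power_mod_periodic)
  moreover have "b + (j mod f) * P + (j div f) * (f * P) = b + j * P"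
    by (metis add.assoc add.commute div_mult_mod_eq distrib_right mult.assoc)
  ultimately have "[z = w] (mod m)"
    using red [of "j mod f"] by (simp add: z_def w_def cong_def)
  \<comment> \<open>All exponents are at least \<open>s\<close>, so \<open>z\<close> exceeds its
    last digits \<open>l\<close>; folding needs \<open>z - l\<close> to be positive.\<close>
  moreover have "q ^ s \<le> z"
    unfolding z_def using assms(3,4) by (intro power_increasing) auto
  with \<open>l < q ^ s\<close> have "l < z" by linarith
  ultimately have "[z - l = y] (mod m)"
    using cong_diff_mod [of m l z w] \<open>m > 0\<close> fold_rep_cong
    unfolding y_def by (meson cong_sym cong_trans less_imp_le)
  then have "digit_sum p y \<le> digit_sum p (z - l)"
    using fold_rep_bounds [OF \<open>m > 0\<close>] \<open>l < z\<close> assms(2) unfolding m_def y_def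
    by (intro digit_sum_fold_le [of p _ _ n]) auto
  \<comment> \<open>What remains is the leading part followed by \<open>N\<close> zeros.\<close>
  also have "z - l = p ^ N * (z div p ^ N)"
    using zl minus_mod_eq_mult_div [of z "p ^ N"] by simp
  also have "digit_sum p \<dots> = digit_sum p (z div p ^ N)"
    using assms(2) by (rule digit_sum_mult_base)
  finally show ?thesis
    using cycle_check_sound(2) [OF cycle, of "j mod f"] \<open>f > 0\<close>
      digit_sum_split [OF assms(2), of z N] zl by (simp add: z_def w_def y_def)
qed

text \<open>In the second claim \<open>i\<close> selects the branch and \<open>j\<close> counts
  steps of the refined period \<open>Q\<close>. The bound \<open>s\<close> persists because starting
  exponents only grow.\<close>

lemma refutes_sound:
  shows "refutes p q h s b P c \<Longrightarrow> p \<ge> 2 \<Longrightarrow> q \<ge> 2 \<Longrightarrow> s \<le> b \<Longrightarrow>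
           [q ^ (b + j * P) = 1] (mod p ^ h) \<Longrightarrow> 9 < digit_sum p (q ^ (b + j * P))"
    and "refutes_all p q h s b P Q cs \<Longrightarrow> p \<ge> 2 \<Longrightarrow> q \<ge> 2 \<Longrightarrow> s \<le> b \<Longrightarrow> i < length cs \<Longrightarrow>
           [q ^ (b + i * P + j * Q) = 1] (mod p ^ h) \<Longrightarrow>
           9 < digit_sum p (q ^ (b + i * P + j * Q))"
proof (induction p q h s b P c and p q h s b P Q cs arbitrary: j and i j
    rule: refutes_refutes_all.induct)
  case (1 p q h s b P N)
  then show ?case using refutes_Cong_sound by blast
next
  case (2 p q h s b P N n f)
  then show ?case using refutes_Fold_sound by blast
next
  case (3 p q h s b P cs)
  define f where "f = length cs"
  have "f > 0" and all: "refutes_all p q h s b P (P * f) cs"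
    using 3 by (auto simp: f_def)
  have eq: "b + j * P = b + (j mod f) * P + (j div f) * (P * f)"
    by (metis add.assoc add.commute div_mult_mod_eq distrib_right mult.assoc mult.commute)
  have "j mod f < length cs"
    using \<open>f > 0\<close> by (simp add: f_def)
  then show ?case
    using "3.IH" [of "j mod f" "j div f"] all "3.prems" eq by (simp add: f_def add.assoc)
next
  case (5 p q h s b P Q c cs)
  show ?case
  proof (cases i)
    case 0
    then show ?thesis using "5.IH"(1) [of j] "5.prems" by simp
  next
    case (Suc i')
    then show ?thesis using "5.IH"(2) [of i' j] "5.prems" by (simp add: algebra_simps)
  qed
qed simp



section \<open>Numeral evaluation and the certificates\<close>

lemma digit_sum_eval:
  "digit_sum (numeral (num.Bit0 k)) (Suc 0) = 1"
  "digit_sum (numeral (num.Bit1 k)) (Suc 0) = 1"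
  "digit_sum (numeral (num.Bit0 k)) (numeral x) =
    numeral x mod numeral (num.Bit0 k) + digit_sum (numeral (num.Bit0 k)) (numeral x div numeral (num.Bit0 k))"
  "digit_sum (numeral (num.Bit1 k)) (numeral x) =
    numeral x mod numeral (num.Bit1 k) + digit_sum (numeral (num.Bit1 k)) (numeral x div numeral (num.Bit1 k))"
proof -
  show "digit_sum (numeral (num.Bit0 k)) (Suc 0) = 1"
    using digit_sum_power [of "numeral (num.Bit0 k)" 0] by simp
  show "digit_sum (numeral (num.Bit1 k)) (Suc 0) = 1"
    using digit_sum_power [of "numeral (num.Bit1 k)" 0] by simp
qed (rule digit_sum_rec, simp)+

text \<open>The digit sum rules match only literal bases, at least 2 by their shape, and literal
  positive arguments, so unfolding stops. The successor equation of \<open>cycle_check\<close> is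
  restated for numeral counters.\<close>

lemmas refutes_eval =
  numeral_2_eq_2 [symmetric] cong_check_def fold_check_def fold_rep_def digit_sum_eval
  cycle_check.simps(2) [of _ _ _ _ _ _ _ "pred_numeral k" for k, folded numeral_eq_Suc]

text \<open>The parameters \<open>7 7 7 1\<close> cover all exponents from 7 on, under the
  congruence modulo \<open>p ^ 7\<close>. In the first certificate \<open>Cong 2\<close> removes the
  exponents 7, 9, ..., as odd powers of 3 are 3 modulo 4.\<close>

lemma certificates_2:
  "refutes 2 3 7 7 7 1 (Split [Cong 2, Split [Split [Split [Cong 6, Fold 6 24 15], Cong 5],
    Cong 4]])"
  "refutes 2 5 7 7 7 1 (Split [Cong 3, Split [Split [Split [Fold 5 20 5, Fold 5 18 3,
    Fold 5 18 3], Cong 5], Cong 4]])"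
  "refutes 2 7 7 7 7 1 (Split [Cong 2, Split [Split [Split [Split [Cong 7, Fold 7 24 5],
    Fold 6 18 3, Fold 6 20 5], Cong 6], Cong 5]])"
  "refutes 2 11 7 7 7 1 (Split [Cong 2, Split [Split [Split [Fold 5 24 2, Fold 5 36 9,
    Fold 5 12 1], Cong 5], Cong 4]])"
  "refutes 2 13 7 7 7 1 (Split [Cong 3, Split [Split [Split [Fold 5 18 3, Fold 5 18 3,
    Fold 5 36 9], Cong 5], Cong 4]])"
  "refutes 2 17 7 7 7 1 (Split [Cong 5, Split [Split [Fold 7 36 9, Cong 7], Cong 6]])"
  "refutes 2 19 7 7 7 1 (Split [Cong 2, Split [Split [Split [Cong 6, Fold 6 24 3], Cong 5],
    Cong 4]])"
  by (simp_all add: refutes_eval)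

lemma certificates_3:
  "refutes 3 2 7 7 7 1 (Split [Cong 1, Split [Cong 2, Cong 2, Split [Cong 3, Fold 3 12 2,
    Cong 3]]])"
  "refutes 3 5 7 7 7 1 (Split [Cong 1, Split [Cong 2, Cong 2, Split [Cong 3, Fold 3 12 4,
    Cong 3]]])"
  "refutes 3 7 7 7 7 1 (Split [Cong 2, Cong 2, Split [Split [Fold 2 6 1, Split [Cong 3,
    Split [Fold 4 18 7, Cong 4, Cong 4], Cong 3]], Fold 2 12 4]])"
  "refutes 3 11 7 7 7 1 (Split [Cong 1, Split [Cong 2, Cong 2, Split [Cong 3, Fold 3 12 4,
    Cong 3]]])"
  "refutes 3 13 7 7 7 1 (Split [Cong 2, Cong 2, Split [Fold 3 12 8, Cong 3, Cong 3]])"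
  "refutes 3 17 7 7 7 1 (Split [Cong 1, Split [Cong 3, Cong 3, Fold 3 6 1]])"
  "refutes 3 19 7 7 7 1 (Split [Cong 3, Cong 3, Split [Fold 4 12 4, Cong 4, Cong 4]])"
  by (simp_all add: refutes_eval)

lemma certificates_5:
  "refutes 5 2 7 7 7 1 (Split [Split [Cong 1, Cong 1], Split [Split [Cong 2, Cong 2, Cong 2,
    Fold 2 6 3, Cong 2], Cong 1]])"
  "refutes 5 3 7 7 7 1 (Split [Split [Cong 1, Cong 1], Split [Split [Cong 2, Cong 2, Cong 2,
    Fold 2 6 3, Cong 2], Cong 1]])"
  "refutes 5 7 7 7 7 1 (Split [Split [Cong 1, Cong 1], Split [Split [Cong 3, Cong 3, Cong 3,
    Fold 3 6 3, Cong 3], Cong 1]])"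
  "refutes 5 11 7 7 7 1 (Split [Cong 2, Cong 2, Cong 2, Split [Split [Fold 2 9 23, Fold 2 3 1],
    Fold 2 3 2, Fold 2 6 2], Cong 2])"
  "refutes 5 13 7 7 7 1 (Split [Split [Cong 1, Cong 1], Split [Split [Cong 2, Cong 2, Cong 2,
    Fold 2 6 3, Cong 2], Cong 1]])"
  "refutes 5 17 7 7 7 1 (Split [Split [Cong 1, Cong 1], Split [Split [Cong 2, Cong 2, Cong 2,
    Fold 2 5 1, Cong 2], Cong 1]])"
  "refutes 5 19 7 7 7 1 (Split [Cong 1, Split [Cong 2, Fold 2 6 3, Cong 2, Cong 2, Cong 2]])"
  by (simp_all add: refutes_eval)

lemma certificates_7:
  "refutes 7 2 7 7 7 1 (Split [Cong 1, Cong 1, Split [Cong 2, Cong 2, Cong 2, Cong 2,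
    Fold 2 6 6, Cong 2, Cong 2]])"
  "refutes 7 3 7 7 7 1 (Split [Split [Cong 1, Cong 1], Split [Cong 1, Cong 1], Split [Cong 1,
    Split [Cong 2, Cong 2, Cong 2, Cong 2, Cong 2, Split [Split [Fold 2 6 1, Fold 2 12 10],
    Fold 2 3 1, Fold 2 6 2], Cong 2]]])"
  "refutes 7 5 7 7 7 1 (Split [Split [Cong 1, Cong 1, Cong 1], Split [Cong 1, Cong 1,
    Split [Split [Fold 1 2 1, Fold 1 6 7], Fold 1 3 1, Fold 1 3 1]]])"
  "refutes 7 11 7 7 7 1 (Split [Cong 1, Cong 1, Fold 1 3 2])"
  "refutes 7 13 7 7 7 1 (Split [Cong 1, Split [Fold 1 2 1, Split [Cong 2, Fold 2 6 9, Cong 2,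
    Cong 2, Cong 2, Cong 2, Cong 2]]])"
  "refutes 7 17 7 7 7 1 (Split [Split [Cong 1, Cong 1, Cong 1], Split [Cong 1, Cong 1,
    Fold 1 2 1]])"
  "refutes 7 19 7 7 7 1 (Split [Split [Cong 1, Cong 1, Cong 1], Split [Split [Cong 1,
    Fold 3 2 1, Cong 1], Split [Fold 0 4 2, Split [Fold 0 8 10, Fold 0 4 1], Split [Fold 0 8 10,
    Fold 0 4 1], Split [Fold 0 4 1, Split [Fold 3 12 7, Cong 1, Cong 1]], Split [Fold 0 4 1,
    Fold 0 8 10]]]])"
  by (simp_all add: refutes_eval)

lemma certificates_11:
  "refutes 11 2 7 7 7 1 (Split [Split [Cong 1, Cong 1, Cong 1, Cong 1, Cong 1], Split [Cong 1,
    Fold 1 4 6, Cong 1, Cong 1, Cong 1]])"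
  "refutes 11 3 7 7 7 1 (Split [Cong 1, Cong 1, Cong 1, Split [Cong 3, Cong 3, Cong 3, Cong 3,
    Cong 3, Cong 3, Cong 3, Cong 3, Cong 3, Split [Cong 4, Cong 4, Cong 4, Cong 4, Cong 4,
    Cong 4, Cong 4, Cong 4, Cong 4, Cong 4, Split [Cong 5, Cong 5, Cong 5, Cong 5, Cong 5,
    Cong 5, Cong 5, Cong 5, Cong 5, Cong 5, Split [Split [Fold 5 3 4, Fold 5 6 4,
    Split [Fold 5 6 2, Split [Fold 5 1 1, Fold 5 9 37]]], Split [Fold 5 3 4, Fold 5 9 148,
    Split [Fold 5 6 2, Split [Fold 5 3 1, Fold 5 9 37]]], Split [Split [Split [Fold 5 3 1,
    Fold 5 9 37], Fold 5 3 2], Split [Split [Fold 5 9 37, Fold 5 1 1], Fold 5 3 2],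
    Fold 5 3 4]]]], Cong 3], Cong 1])"
  "refutes 11 5 7 7 7 1 (Split [Cong 1, Cong 1, Cong 1, Split [Split [Fold 1 3 3, Fold 1 4 2,
    Fold 1 3 3], Fold 1 5 161], Cong 1])"
  "refutes 11 7 7 7 7 1 (Split [Split [Cong 1, Cong 1, Cong 1, Cong 1, Cong 1],
    Split [Split [Fold 0 6 2, Fold 0 6 2, Split [Split [Fold 1 1 1, Fold 1 12 31], Cong 1,
    Cong 1, Cong 1, Cong 1]], Split [Fold 1 3 2, Cong 1, Cong 1, Cong 1, Cong 1], Split [Cong 1,
    Cong 1, Cong 1, Fold 1 4 2, Cong 1]]])"
  "refutes 11 13 7 7 7 1 (Split [Split [Cong 1, Cong 1, Cong 1, Cong 1, Cong 1],
    Split [Split [Cong 1, Cong 1, Cong 1, Fold 1 1 1, Cong 1], Split [Fold 0 4 1,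
    Split [Fold 0 6 1, Fold 0 3 1, Split [Cong 1, Cong 1, Split [Fold 2 9 11, Cong 2, Cong 2,
    Cong 2, Cong 2, Cong 2, Cong 2, Cong 2, Cong 2, Cong 2, Cong 2], Cong 1, Cong 1]],
    Fold 0 4 1]]])"
  "refutes 11 17 7 7 7 1 (Split [Split [Cong 1, Cong 1, Cong 1, Cong 1, Cong 1], Split [Cong 1,
    Split [Fold 1 6 6, Fold 1 4 2, Fold 1 4 2], Cong 1, Cong 1, Cong 1]])"
  "refutes 11 19 7 7 7 1 (Split [Split [Cong 1, Cong 1, Cong 1, Cong 1, Cong 1], Fold 0 3 3])"
  by (simp_all add: refutes_eval)

lemma certificates_13:
  "refutes 13 2 7 7 7 1 (Split [Split [Fold 0 2 1, Split [Cong 1, Cong 1], Split [Cong 1,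
    Cong 1]], Split [Fold 0 2 1, Split [Cong 1, Cong 1], Fold 0 2 1]])"
  "refutes 13 3 7 7 7 1 (Split [Cong 1, Cong 1, Split [Cong 2, Cong 2, Cong 2, Cong 2, Cong 2,
    Cong 2, Cong 2, Cong 2, Cong 2, Cong 2, Split [Fold 2 6 5, Split [Split [Split [Fold 2 4 1,
    Fold 2 12 35], Fold 2 4 2], Fold 2 4 4]], Cong 2, Cong 2]])"
  "refutes 13 5 7 7 7 1 (Split [Split [Cong 1, Cong 1], Split [Fold 1 1 1, Cong 1]])"
  "refutes 13 7 7 7 7 1 (Split [Split [Split [Cong 1, Cong 1, Cong 1], Split [Cong 1, Cong 1,
    Cong 1]], Fold 0 2 1])"
  "refutes 13 11 7 7 7 1 (Split [Fold 0 1 1, Split [Fold 0 2 1, Split [Cong 1, Cong 1],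
    Split [Fold 1 1 1, Cong 1]]])"
  "refutes 13 17 7 7 7 1 (Split [Split [Cong 1, Cong 1], Split [Cong 1, Cong 1], Split [Cong 1,
    Fold 1 1 1]])"
  "refutes 13 19 7 7 7 1 (Split [Split [Split [Cong 1, Cong 1], Split [Cong 1, Cong 1]],
    Fold 0 2 2, Split [Fold 0 2 1, Split [Fold 2 1 1, Cong 1]]])"
  by (simp_all add: refutes_eval)

text \<open>In the first case \<open>2 ^ b\<close> is a positive multiple of 16 = 17 - 1, hence
  folds to the single digit 16.\<close>

lemma certificates_17:
  "refutes 17 2 7 7 7 1 (Fold 0 1 1)"
  "refutes 17 3 7 7 7 1 (Split [Fold 0 2 4, Split [Fold 0 2 2, Split [Split [Cong 1, Cong 1],
    Split [Cong 1, Cong 1]]]])"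
  "refutes 17 5 7 7 7 1 (Split [Split [Fold 0 1 1, Split [Split [Cong 1, Cong 1], Split [Cong 1,
    Cong 1]]], Split [Split [Split [Cong 1, Fold 1 1 1], Split [Cong 1, Cong 1]],
    Split [Split [Cong 1, Cong 1], Split [Cong 1, Cong 1]]]])"
  "refutes 17 7 7 7 7 1 (Split [Split [Split [Split [Cong 1, Cong 1], Split [Cong 1, Cong 1]],
    Split [Split [Cong 1, Cong 1], Split [Cong 1, Cong 1]]], Split [Split [Split [Cong 1,
    Fold 1 1 1], Split [Cong 1, Cong 1]], Fold 0 2 3]])"
  "refutes 17 11 7 7 7 1 (Split [Split [Split [Split [Cong 1, Cong 1], Split [Cong 1, Cong 1]],
    Fold 0 1 1], Split [Split [Split [Cong 1, Fold 1 1 1], Split [Cong 1, Cong 1]],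
    Split [Split [Cong 1, Cong 1], Split [Cong 1, Cong 1]]]])"
  "refutes 17 13 7 7 7 1 (Split [Split [Cong 1, Cong 1], Split [Fold 1 1 1, Cong 1]])"
  "refutes 17 19 7 7 7 1 (Split [Split [Fold 0 1 1, Split [Cong 1, Cong 1]],
    Split [Split [Fold 1 1 1, Cong 1], Split [Cong 1, Cong 1]]])"
  by (simp_all add: refutes_eval)

lemma certificates_19:
  "refutes 19 2 7 7 7 1 (Split [Fold 0 2 4, Fold 0 2 4, Split [Split [Cong 1, Cong 1, Cong 1],
    Fold 0 1 1]])"
  "refutes 19 3 7 7 7 1 (Split [Split [Split [Cong 1, Cong 1, Cong 1], Split [Cong 1, Cong 1,
    Cong 1]], Split [Split [Cong 1, Cong 1, Cong 1], Split [Cong 1, Cong 1, Cong 1]],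
    Split [Split [Fold 0 3 2, Fold 0 3 2, Split [Cong 1, Fold 1 6 14], Fold 0 3 2,
    Split [Cong 1, Fold 1 3 1], Fold 0 3 2, Fold 0 3 2], Split [Cong 1, Cong 1], Split [Cong 1,
    Cong 1]]])"
  "refutes 19 5 7 7 7 1 (Split [Split [Cong 1, Cong 1, Cong 1], Split [Cong 1, Cong 1, Cong 1],
    Fold 0 2 2])"
  "refutes 19 7 7 7 7 1 (Split [Cong 1, Cong 1, Fold 1 1 1])"
  "refutes 19 11 7 7 7 1 (Split [Cong 1, Cong 1, Fold 1 1 2])"
  "refutes 19 13 7 7 7 1 (Split [Fold 0 1 1, Split [Fold 0 2 2, Split [Cong 1, Cong 1, Cong 1]],
    Split [Fold 0 2 2, Split [Cong 1, Fold 1 1 1, Cong 1]]])"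
  "refutes 19 17 7 7 7 1 (Split [Split [Cong 1, Cong 1, Cong 1], Split [Cong 1, Cong 1, Cong 1],
    Split [Fold 1 1 2, Cong 1, Cong 1]])"
  by (simp_all add: refutes_eval)

text \<open>With \<open>h = 0\<close> the congruence is vacuous, so only \<open>Fold\<close> can
  refute. The start is 3 because 17 and 289 have digit sums 5 and 9 in base 5.\<close>

lemma certificate_17_powers:
  "refutes 5 17 0 3 3 1 (Split [Fold 0 5 4, Fold 0 5 4, Split [Split [Fold 1 5 1, Fold 2 2 1],
    Split [Fold 2 4 3, Fold 1 5 1]], Split [Split [Fold 1 5 1, Fold 1 5 1], Split [Fold 0 12 6,
    Fold 2 2 1]], Split [Split [Fold 2 2 1, Split [Fold 0 6 1, Fold 0 6 1, Fold 1 4 1]],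
    Split [Fold 0 12 6, Split [Fold 2 3 1, Fold 2 3 1, Split [Fold 0 8 2, Fold 0 8 2,
    Fold 2 8 2, Fold 1 8 2, Fold 0 8 2, Fold 0 8 2, Fold 0 8 2, Fold 0 8 2, Fold 0 8 2,
    Fold 0 8 2, Fold 0 8 2, Fold 1 8 2, Split [Fold 0 8 1, Split [Fold 3 1 1, Fold 3 2 1,
    Fold 0 24 25, Fold 3 1 1, Split [Fold 0 24 5, Fold 4 1 1, Fold 0 24 5, Fold 4 1 1,
    Fold 4 1 1]]]]]]]])"
  by (simp add: refutes_eval)

section \<open>Digit sum bounds for all admissible powers\<close>

lemma prime_le_19:
  fixes p :: nat
  assumes "prime p" "p \<le> 19"
  shows "p \<in> {2, 3, 5, 7, 11, 13, 17, 19}"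
proof -
  have "p \<in> {..<20}" using assms(2) by simp
  also have "{..<20} = {0, 1, 2, 3, 4, 5, 6, 7, 8, 9, 10, 11, 12, 13, 14, 15, 16, 17, 18, 19 :: nat}"
    by (auto simp: lessThan_Suc eval_nat_numeral)
  finally have p: "p \<in> {0, 1, 2, 3, 4, 5, 6, 7, 8, 9, 10, 11, 12, 13, 14, 15, 16, 17, 18, 19}" .
  \<comment> \<open>As 19 is less than 25, divisibility by 2 and 3 detects every composite in
    range.\<close>
  have "\<not> 2 dvd p" if "p \<noteq> 2" using assms(1) that by (metis primes_dvd_imp_eq two_is_prime_nat)
  moreover have "\<not> 3 dvd p" if "p \<noteq> 3"
    using assms(1) that primes_dvd_imp_eq [of 3 p] by auto
  moreover have "p \<noteq> 1" "p \<noteq> 0" using assms(1) by auto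
  ultimately show ?thesis using p by auto
qed

lemma certificate_exists:
  assumes "prime p" "prime q" "p \<noteq> q" "p \<le> 19" "q \<le> 19"
  shows "\<exists>c. refutes p q 7 7 7 1 c"
proof -
  have "p \<in> {2, 3, 5, 7, 11, 13, 17, 19}" "q \<in> {2, 3, 5, 7, 11, 13, 17, 19}"
    using assms prime_le_19 by blast+
  then show ?thesis
    using assms(3)
      certificates_2 certificates_3 certificates_5 certificates_7
      certificates_11 certificates_13 certificates_17 certificates_19
    \<comment> \<open>Of the 64 pairs, 8 contradict \<open>p \<noteq> q\<close> and the other 56
      have certificates.\<close>
    by (elim insertE emptyE) (hypsubst, (simp only: simp_thms; fail | blast))+
qed

lemma digit_sum_power_gt:
  assumes "prime p" "prime q" "p \<noteq> q" "p \<le> 19" "q \<le> 19" "b \<ge> 7" "[q ^ b = 1] (mod p ^ 7)"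
  shows "9 < digit_sum p (q ^ b)"
proof -
  obtain c where "refutes p q 7 7 7 1 c"
    using certificate_exists assms(1-5) by blast
  moreover have "b = 7 + (b - 7) * 1" using assms(6) by simp
  ultimately show ?thesis
    using refutes_sound(1) [of p q 7 7 7 1 c "b - 7"] assms(7) prime_ge_2_nat [OF assms(1)]
      prime_ge_2_nat [OF assms(2)] by simp
qed

lemma digit_sum_17_power_gt:
  assumes "b \<ge> 3"
  shows "9 < digit_sum 5 (17 ^ b)"
proof -
  have "b = 3 + (b - 3) * 1" using assms by simp
  then show ?thesis
    using refutes_sound(1) [OF certificate_17_powers, of "b - 3"] by simp
qed

section \<open>The two equations\<close>

lemma digit_sum_Suc_sum_powers_le:
  assumes "p \<ge> 2" "finite A"
  shows "digit_sum p (1 + (\<Sum>i\<in>A. p ^ f i)) \<le> 1 + card A"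
  using digit_sum_add_le [OF assms(1), of 1 "\<Sum>i\<in>A. p ^ f i"] digit_sum_power [OF assms(1), of 0]
    digit_sum_sum_powers_le [OF assms, of f] by simp

text \<open>If all exponents were at least 7, the powers of \<open>p\<close> would vanish modulo
  \<open>p ^ 7\<close>. Then \<open>q ^ \<alpha> t\<close> would be 1 there and have digit sum above
  9, against the bound \<open>t\<close> from the sum.\<close>

lemma sum_powers_eq_power_Min_le_6:
  fixes t p q :: nat and \<alpha> :: "nat \<Rightarrow> nat"
  assumes "3 \<le> t" "t \<le> 9" "prime p" "prime q" "p \<noteq> q" "p \<le> 19" "q \<le> 19"
    and eq: "1 + (\<Sum>i=1..t-1. int p ^ \<alpha> i) - int q ^ \<alpha> t = 0"
  shows "Min (\<alpha> ` {1..t}) \<le> 6"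
proof (rule ccontr)
  assume "\<not> ?thesis"
  then have ge: "\<alpha> i \<ge> 7" if "i \<in> {1..t}" for i
    using Min_le [OF finite_imageI [OF finite_atLeastAtMost] imageI [OF that], of \<alpha>] by linarith
  have "int (q ^ \<alpha> t) = int (1 + (\<Sum>i=1..t-1. p ^ \<alpha> i))"
    using eq by simp
  then have q: "q ^ \<alpha> t = 1 + (\<Sum>i=1..t-1. p ^ \<alpha> i)"
    by (simp only: of_nat_eq_iff)
  have "p ^ 7 dvd (\<Sum>i=1..t-1. p ^ \<alpha> i)"
    using ge by (intro dvd_sum le_imp_power_dvd) auto
  then have "[q ^ \<alpha> t = 1 + 0] (mod p ^ 7)"
    unfolding q by (intro cong_add cong_refl) (simp add: cong_0_iff)
  then have "9 < digit_sum p (q ^ \<alpha> t)"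
    using assms ge [of t] by (intro digit_sum_power_gt) auto
  also have "\<dots> \<le> 1 + card {1..t-1}"
    unfolding q using prime_ge_2_nat [OF assms(3)] by (intro digit_sum_Suc_sum_powers_le) auto
  finally show False using assms(1,2) by simp
qed

text \<open>A sorted list is determined by its multiset, so four multiplicities can replace the
  unknown exponents.\<close>

lemma sorted_less_4_eq_replicate:
  fixes xs :: "nat list"
  assumes "sorted xs" "\<And>x. x \<in> set xs \<Longrightarrow> x < 4"
  obtains c0 c1 c2 c3 where
    "xs = replicate c0 0 @ replicate c1 1 @ replicate c2 2 @ replicate c3 3"
proof -
  define ys where "ys = replicate (count_list xs 0) 0 @ replicate (count_list xs 1) 1 @
    replicate (count_list xs 2) 2 @ replicate (count_list xs 3) (3 :: nat)"
  have "mset xs = mset ys"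
  proof (rule multiset_eqI)
    fix x :: nat
    consider "x = 0" | "x = 1" | "x = 2" | "x = 3" | "x \<ge> 4" by linarith
    then show "count (mset xs) x = count (mset ys) x"
    proof cases
      case 5
      then have "x \<notin> set xs" "x \<notin> set ys" using assms(2) [of x] by (auto simp: ys_def)
      then show ?thesis by (metis count_mset_0_iff)
    qed (simp_all add: ys_def count_mset)
  qed
  moreover have "sorted ys"
    by (auto simp: ys_def sorted_append)
  ultimately have "xs = ys"
    using assms(1) by (metis properties_for_sort)
  then show ?thesis using that ys_def by blast
qed

lemma powers_of_5_sum_17_power:
  assumes "length a = 9" "sorted (take 8 a)"
    and eq: "1 + (\<Sum>i<8. (5::int) ^ (a ! i)) - (17::int) ^ (a ! 8) = 0"
  shows "a \<in> {[0,0,0,0,0,0,1,1,1], [0,0,0,1,1,2,3,3,2]}"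
proof -
  define b where "b = a ! 8"
  have "int (17 ^ b) = int (1 + (\<Sum>i<8. 5 ^ (a ! i)))"
    using eq by (simp add: b_def)
  then have sum: "17 ^ b = (1::nat) + (\<Sum>i<8. 5 ^ (a ! i))"
    by (simp only: of_nat_eq_iff)
  have "digit_sum 5 (17 ^ b) \<le> 9"
    unfolding sum using digit_sum_Suc_sum_powers_le [of 5 "{..<8}" "\<lambda>i. a ! i"] by simp
  then have "b < 3" using digit_sum_17_power_gt [of b] by linarith
  \<comment> \<open>The sum with its summand 1 is at least 9, which excludes exponent 0 for
    17.\<close>
  moreover have "(\<Sum>i<8. 5 ^ (a ! i)) \<ge> (\<Sum>i<8::nat. 1 :: nat)"
    by (intro sum_mono) simp
  then have "8 \<le> (\<Sum>i<8. 5 ^ (a ! i) :: nat)" by simp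
  then have "17 ^ b \<noteq> (1::nat)" using sum by linarith
  then have "b \<noteq> 0" by (intro notI) simp
  ultimately have b: "b = 1 \<or> b = 2" by linarith
  \<comment> \<open>A single term \<open>5 ^ 4 = 625\<close> would exceed
    \<open>17 ^ 2 = 289\<close>.\<close>
  have small: "x < 4" if "x \<in> set (take 8 a)" for x
  proof -
    from that obtain i where i: "i < 8" "x = a ! i"
      using assms(1) by (auto simp: in_set_conv_nth)
    then have "5 ^ x \<le> (\<Sum>i<8. 5 ^ (a ! i) :: nat)"
      by (auto intro: member_le_sum)
    also have "\<dots> < 5 ^ 4" using sum b by auto
    finally show ?thesis by (rule power_less_imp_less_exp [rotated]) simp
  qed
  obtain c0 c1 c2 c3 where c:
    "take 8 a = replicate c0 0 @ replicate c1 1 @ replicate c2 2 @ replicate c3 3"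
    using sorted_less_4_eq_replicate [OF assms(2) small] .
  have len: "c0 + c1 + c2 + c3 = 8"
    using arg_cong [OF c, of length] assms(1) by simp
  have "(\<Sum>i<8. 5 ^ (a ! i)) = sum_list (map (\<lambda>x. 5 ^ x) (take 8 a))"
    using assms(1) by (simp add: sum_list_sum_nth atLeast0LessThan)
  also have "\<dots> = c0 + 5 * c1 + 25 * c2 + 125 * c3"
    unfolding c by (simp add: sum_list_replicate)
  finally have total: "17 ^ b = 1 + (c0 + 5 * c1 + 25 * c2 + 125 * c3)"
    using sum by simp
  have a: "a = take 8 a @ [b]"
    using assms(1) by (metis b_def append_take_drop_id Cons_nth_drop_Suc drop_all eval_nat_numeral(3)
        le_refl lessI semiring_norm(26) semiring_norm(27))
  from b show ?thesis
  proof
    assume "b = 1"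
    then have *: "c0 + 5 * c1 + 25 * c2 + 125 * c3 = 16" using total by simp
    then have "c2 = 0" "c3 = 0" by linarith+
    \<comment> \<open>Subtracting \<open>c0 + c1 = 8\<close> from \<open>c0 + 5 * c1 = 16\<close>
      leaves \<open>4 * c1 = 8\<close>.\<close>
    with * len have "c0 = 6 \<and> c1 = 2 \<and> c2 = 0 \<and> c3 = 0" by linarith
    then show ?thesis using a c \<open>b = 1\<close> by (simp add: eval_nat_numeral)
  next
    assume "b = 2"
    \<comment> \<open>Three terms 125 exceed 288. Subtracting the count 8 from the total 288 and
      dividing by 4 gives the second equation.\<close>
    then have *: "c3 \<le> 2" "c1 + 6 * c2 + 31 * c3 = 70" using total len by simp_all
    have "c0 = 3 \<and> c1 = 2 \<and> c2 = 1 \<and> c3 = 2" 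
    proof -
      have "c3 = 2"
      proof (rule ccontr)
        assume "c3 \<noteq> 2"
        with *(1) have "c3 = 0 \<or> c3 = 1" by linarith
        then show False
        proof
          assume "c3 = 1"
          \<comment> \<open>Here \<open>c1 + 6 * c2 = 39\<close> and \<open>c1 + c2 \<le> 7\<close>,
            so \<open>5 * c2 \<ge> 32\<close>; but \<open>6 * 7 > 39\<close>.\<close>
          moreover from this have "c2 \<ge> 7" using *(2) len by linarith
          ultimately show False using *(2) by linarith
        qed (use *(2) len in linarith)
      qed
      \<comment> \<open>Now \<open>c1 + 6 * c2 = 8\<close>, while \<open>c1 + c2 \<le> 6\<close>
        excludes \<open>c2 = 0\<close>.\<close>
      moreover from this have "c2 \<ge> 1" "c2 \<le> 1" using *(2) len by linarith+
      ultimately show ?thesis using *(2) len by linarith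
    qed
    then show ?thesis using a c \<open>b = 2\<close> by (simp add: eval_nat_numeral)
  qed
qed

theorem theorem5:
  shows "(\<forall>(t::nat) (p::nat) (q::nat) (\<alpha>::nat \<Rightarrow> nat).
            3 \<le> t \<and> t \<le> 9 \<and> prime p \<and> prime q \<and> p \<noteq> q \<and> p \<le> 19 \<and> q \<le> 19 \<and>
            1 + (\<Sum>i=1..t-1. (int p) ^ \<alpha> i) - (int q) ^ \<alpha> t = 0
            \<longrightarrow> Min (\<alpha> ` {1..t}) \<le> 6)
       \<and> {a :: nat list. length a = 9 \<and> sorted (take 8 a) \<and>
            1 + (\<Sum>i<8. (5::int) ^ (a ! i)) - (17::int) ^ (a ! 8) = 0}
         = {[0,0,0,0,0,0,1,1,1], [0,0,0,1,1,2,3,3,2]}"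
proof (intro conjI allI impI equalityI subsetI)
  fix a :: "nat list"
  assume "a \<in> {[0,0,0,0,0,0,1,1,1], [0,0,0,1,1,2,3,3,2]}"
  then show "a \<in> {a. length a = 9 \<and> sorted (take 8 a) \<and>
      1 + (\<Sum>i<8. (5::int) ^ (a ! i)) - (17::int) ^ (a ! 8) = 0}"
    by (auto simp: eval_nat_numeral)
qed (use sum_powers_eq_power_Min_le_6 powers_of_5_sum_17_power in blast)+

end
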